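(* Let $(\mathcal E,d)$ be a Polish metric space and let $p\in[1,+\infty)$. Then for all $\lambda,\mu,\nu\in\mathcal P_p(\mathcal E)$, $$\mathcal W_p(\lambda,\nu)\le\mathcal W_p(\lambda,\mu)+\mathcal W_p(\mu,\nu)\,.$$
   Context: A Polish metric space is a complete separable metric space. $\mathcal P(\mathcal E)$ denotes the set of Borel probability measures on $\mathcal E$. For $p\ge 1$, $\mathcal P_p(\mathcal E)$ is the set of $\mu\in\mathcal P(\mathcal E)$ such that $\int_{\mathcal E}d(x_0,x)^p\,\mu(dx)<\infty$ for some (equivalently, every) $x_0\in\mathcal E$. For $\mu,\nu\in\mathcal P(\mathcal E)$, $\mathcal C(\mu,\nu)$ is the set of couplings of $\mu$ and $\nu$, i.e. the set of Borel probability measures $\rho$ on $\mathcal E\times\mathcal E$ such that $$\iint_{\mathcal E\times\mathcal E}(\phi(x)+\psi(y))\,\rho(dxdy)=\int_{\mathcal E}\phi(x)\,\mu(dx)+\int_{\mathcal E}\psi(y)\,\nu(dy)$$ for all bounded continuous $\phi,\psi:\mathcal E\to\mathbf R$ (that is, $\rho$ has first marginal $\mu$ and second marginal $\nu$). For $\mu,\nu\in\mathcal P_p(\mathcal E)$, the Wasserstein distance of exponent $p$ is $$\mathcal W_p(\mu,\nu):=\left(\inf_{\rho\in\mathcal C(\mu,\nu)}\iint_{\mathcal E\times\mathcal E}d(x,y)^p\,\rho(dxdy)\right)^{1/p}<+\infty\,.$$ *)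

theory Defs
  imports "HOL-Probability.Probability"
begin

(* A Polish metric space is a type of class polish_space, the library's combination of
   complete_space (complete metric space) and second_countable_topology; for metric
   spaces, second countability is equivalent to separability. *)

definition borel_probs :: "('a::topological_space) measure set" where
  "borel_probs = {\<mu>. prob_space \<mu> \<and> sets \<mu> = sets borel}"

definition borel_probs_moment :: "real \<Rightarrow> ('a::polish_space) measure set" where
  "borel_probs_moment p =
     {\<mu> \<in> borel_probs. \<exists>x0. (\<integral>\<^sup>+ x. ennreal (dist x0 x powr p) \<partial>\<mu>) < \<infinity>}"

(* The sigma-algebra of a coupling is the Borel sigma-algebra of the product topology on
   'a \<times> 'a. The test functions are bounded and continuous, hence integrable with respect
   to every Borel probability measure, so the Bochner integrals are the usual ones. *)
definition couplings ::
  "('a::polish_space) measure \<Rightarrow> 'a measure \<Rightarrow> ('a \<times> 'a) measure set" where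
  "couplings \<mu> \<nu> =
     {\<rho> \<in> borel_probs. \<forall>\<phi> \<psi> :: 'a \<Rightarrow> real.
        continuous_on UNIV \<phi> \<longrightarrow> bounded (range \<phi>) \<longrightarrow>
        continuous_on UNIV \<psi> \<longrightarrow> bounded (range \<psi>) \<longrightarrow>
        (\<integral>z. \<phi> (fst z) + \<psi> (snd z) \<partial>\<rho>) = (\<integral>x. \<phi> x \<partial>\<mu>) + (\<integral>y. \<psi> y \<partial>\<nu>)}"

definition transport_cost :: "real \<Rightarrow> ('a::polish_space) measure \<Rightarrow> 'a measure \<Rightarrow> ennreal" where
  "transport_cost p \<mu> \<nu> =
     (INF \<rho>\<in>couplings \<mu> \<nu>. \<integral>\<^sup>+ z. ennreal (dist (fst z) (snd z) powr p) \<partial>\<rho>)"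

(* Intended for p \<ge> 1 and measures in borel_probs_moment p, where the infimum is finite
   (transport_cost_finite below), so that enn2real loses no information. *)
definition wasserstein :: "real \<Rightarrow> ('a::polish_space) measure \<Rightarrow> 'a measure \<Rightarrow> real" where
  "wasserstein p \<mu> \<nu> = enn2real (transport_cost p \<mu> \<nu>) powr (1 / p)"

lemma pair_measure_in_couplings:
  fixes \<mu> \<nu> :: "('a::polish_space) measure"
  assumes "\<mu> \<in> borel_probs" "\<nu> \<in> borel_probs"
  shows "\<mu> \<Otimes>\<^sub>M \<nu> \<in> couplings \<mu> \<nu>"
proof -
  interpret \<mu>: prob_space \<mu> using assms by (auto simp: borel_probs_def)
  interpret \<nu>: prob_space \<nu> using assms by (auto simp: borel_probs_def)
  interpret P: pair_prob_space \<mu> \<nu> ..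
  have sets_\<mu>[measurable_cong]: "sets \<mu> = sets borel" and sets_\<nu>[measurable_cong]: "sets \<nu> = sets borel"
    using assms by (auto simp: borel_probs_def)
  have s: "sets (\<mu> \<Otimes>\<^sub>M \<nu>) = sets borel"
    by (metis borel_prod sets_\<mu> sets_\<nu> sets_pair_measure_cong)
  have "(\<integral>z. \<phi> (fst z) + \<psi> (snd z) \<partial>(\<mu> \<Otimes>\<^sub>M \<nu>)) = (\<integral>x. \<phi> x \<partial>\<mu>) + (\<integral>y. \<psi> y \<partial>\<nu>)"
    if c: "continuous_on UNIV \<phi>" "continuous_on UNIV \<psi>"
      and b: "bounded (range \<phi>)" "bounded (range \<psi>)" for \<phi> \<psi> :: "'a \<Rightarrow> real"
  proof -
    obtain B C where B: "\<And>x. norm (\<phi> x) \<le> B" and C: "\<And>x. norm (\<psi> x) \<le> C"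
      using b by (auto simp: bounded_iff)
    have [measurable]: "\<phi> \<in> borel_measurable borel" "\<psi> \<in> borel_measurable borel"
      using c by (auto intro: borel_measurable_continuous_onI)
    have i1: "integrable (\<mu> \<Otimes>\<^sub>M \<nu>) (\<lambda>z. \<phi> (fst z))"
      by (rule P.integrable_const_bound[where B=B]) (use B in auto)
    have i2: "integrable (\<mu> \<Otimes>\<^sub>M \<nu>) (\<lambda>z. \<psi> (snd z))"
      by (rule P.integrable_const_bound[where B=C]) (use C in auto)
    have "(\<integral>z. \<phi> (fst z) \<partial>(\<mu> \<Otimes>\<^sub>M \<nu>)) = (\<integral>x. \<phi> x \<partial>\<mu>)"
      using P.integral_fst'[OF i1] by (simp add: \<nu>.prob_space)
    moreover have "(\<integral>z. \<psi> (snd z) \<partial>(\<mu> \<Otimes>\<^sub>M \<nu>)) = (\<integral>y. \<psi> y \<partial>\<nu>)"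
      using P.integral_fst'[OF i2] by (simp add: \<mu>.prob_space)
    ultimately show ?thesis using i1 i2 by simp
  qed
  then show ?thesis
    using s P.prob_space_axioms by (auto simp: couplings_def borel_probs_def)
qed

lemma transport_cost_finite:
  fixes \<mu> \<nu> :: "('a::polish_space) measure"
  assumes p: "1 \<le> p" and "\<mu> \<in> borel_probs_moment p" "\<nu> \<in> borel_probs_moment p"
  shows "transport_cost p \<mu> \<nu> < \<infinity>"
proof -
  have pr: "\<mu> \<in> borel_probs" "\<nu> \<in> borel_probs" using assms by (auto simp: borel_probs_moment_def)
  interpret \<mu>: prob_space \<mu> using pr by (auto simp: borel_probs_def)
  interpret \<nu>: prob_space \<nu> using pr by (auto simp: borel_probs_def)
  have [measurable_cong]: "sets \<mu> = sets borel" "sets \<nu> = sets borel"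
    using pr by (auto simp: borel_probs_def)
  obtain a b where a: "(\<integral>\<^sup>+ x. ennreal (dist a x powr p) \<partial>\<mu>) < \<infinity>"
    and b: "(\<integral>\<^sup>+ y. ennreal (dist b y powr p) \<partial>\<nu>) < \<infinity>"
    using assms by (auto simp: borel_probs_moment_def)
  let ?K = "ennreal (3 powr p)"
  have pt: "ennreal (dist x y powr p) \<le>
      ?K * (ennreal (dist a x powr p) + ennreal (dist a b powr p) + ennreal (dist b y powr p))" for x y
  proof -
    define m where "m = Max {dist a x, dist a b, dist b y}"
    have "m \<in> {dist a x, dist a b, dist b y}" unfolding m_def by (rule Max_in) auto
    then have m: "m powr p \<le> dist a x powr p + dist a b powr p + dist b y powr p"
      by (auto simp: add_nonneg_nonneg)
    have le: "dist a x \<le> m" "dist a b \<le> m" "dist b y \<le> m" by (auto simp: m_def)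
    have "dist x y \<le> dist a x + dist a b + dist b y"
      using dist_triangle[of x y a] dist_triangle[of a y b] by (simp add: dist_commute)
    then have "dist x y \<le> 3 * m" using le by linarith
    then have "dist x y powr p \<le> (3 * m) powr p" using p by (intro powr_mono2) auto
    also have "\<dots> = 3 powr p * m powr p"
      by (rule powr_mult)
    also have "\<dots> \<le> 3 powr p * (dist a x powr p + dist a b powr p + dist b y powr p)"
      using m by (intro mult_left_mono) auto
    finally have "ennreal (dist x y powr p) \<le>
        ennreal (3 powr p * (dist a x powr p + dist a b powr p + dist b y powr p))"
      by (rule ennreal_leI)
    then show ?thesis by (simp add: ennreal_mult)
  qed
  have "transport_cost p \<mu> \<nu> \<le> (\<integral>\<^sup>+ z. ennreal (dist (fst z) (snd z) powr p) \<partial>(\<mu> \<Otimes>\<^sub>M \<nu>))"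
    unfolding transport_cost_def by (rule INF_lower) (rule pair_measure_in_couplings[OF pr])
  also have "\<dots> \<le> (\<integral>\<^sup>+ z. ?K * (ennreal (dist a (fst z) powr p) + ennreal (dist a b powr p)
      + ennreal (dist b (snd z) powr p)) \<partial>(\<mu> \<Otimes>\<^sub>M \<nu>))"
    by (intro nn_integral_mono pt)
  also have "\<dots> = (\<integral>\<^sup>+ x. (\<integral>\<^sup>+ y. ?K * (ennreal (dist a x powr p) + ennreal (dist a b powr p)
      + ennreal (dist b y powr p)) \<partial>\<nu>) \<partial>\<mu>)"
    by (subst \<nu>.nn_integral_fst[symmetric]) auto
  also have "\<dots> = ?K * ((\<integral>\<^sup>+ x. ennreal (dist a x powr p) \<partial>\<mu>) + ennreal (dist a b powr p)
      + (\<integral>\<^sup>+ y. ennreal (dist b y powr p) \<partial>\<nu>))"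
    by (simp add: nn_integral_cmult nn_integral_add \<mu>.emeasure_space_1 \<nu>.emeasure_space_1)
  also have "\<dots> < \<infinity>" using a b by (simp add: ennreal_mult_less_top)
  finally show ?thesis .
qed

end

theory Submission
  imports Defs
begin

text \<open>
  Instead of gluing two couplings exactly along their common marginal \<open>\<mu>\<close>, which requires
  disintegration, one glues them only up to a countable Borel partition of the space into cells
  of diameter at most \<open>e\<close>: on a pair of cells \<open>\<rho> \<otimes> \<sigma>\<close> is reweighted by \<open>1 / \<mu>(cell)\<close> if the
  two cells coincide and by 0 otherwise. Both \<open>\<rho>\<close> and \<open>\<sigma>\<close> are marginals of the result, and its
  two intermediate points are at distance at most \<open>e\<close>. Minkowski's inequality for three summands
  then gives the triangle inequality up to \<open>e\<close>.
\<close>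

section \<open>Convexity of powers and Minkowski's inequality\<close>

text \<open>Convexity of \<open>t powr p\<close>: the left side is the tangent line at
  \<open>m\<close>. Homogeneity reduces the claim to \<open>m = 1\<close>, where it is Bernoulli's
  inequality.\<close>

lemma powr_above_tangent:
  fixes t m p :: real
  assumes "1 \<le> p" "0 \<le> t" "0 < m"
  shows "m powr p * (1 + p * (t / m - 1)) \<le> t powr p"
proof -
  have "1 + p * (s - 1) \<le> s powr p" if "0 \<le> s" for s :: real
  proof -
    \<comment> \<open>Young's inequality with weights \<open>1 / p\<close> and
      \<open>1 - 1 / p\<close> at \<open>s powr p\<close> and 1; multiplied by \<open>p\<close> it
      becomes Bernoulli's inequality.\<close>
    have "(s powr p) powr (1 / p) * 1 powr (1 - 1 / p) \<le> 1 / p * s powr p + (1 - 1 / p) * 1"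
      using assms that Youngs_inequality_0[of "1 / p" "1 - 1 / p" "s powr p" 1]
      by (cases "s = 0") auto
    then have "s \<le> 1 / p * s powr p + (1 - 1 / p)" using assms that by (simp add: powr_powr)
    then have "p * s \<le> p * (1 / p * s powr p + (1 - 1 / p))"
      using assms by (intro mult_left_mono) auto
    also have "\<dots> = s powr p + (p - 1)" using assms by (simp add: algebra_simps)
    finally show ?thesis by (simp add: algebra_simps)
  qed
  from this[of "t / m"] have "1 + p * (t / m - 1) \<le> (t / m) powr p" using assms by simp
  then have "m powr p * (1 + p * (t / m - 1)) \<le> m powr p * (t / m) powr p"
    by (intro mult_left_mono) auto
  also have "\<dots> = t powr p" using assms by (simp flip: powr_mult)
  finally show ?thesis .
qed

text \<open>Jensen's inequality: average the tangent bounds at the weighted mean \<open>m\<close>;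
  the first-order terms cancel. A zero mean is split off because the tangent bound divides by
  \<open>m\<close>.\<close>

lemma powr_weighted_mean3_le:
  fixes p :: real
  assumes p: "1 \<le> p" and w: "0 \<le> u" "0 \<le> v" "0 \<le> w" "u + v + w = 1"
    and t: "0 \<le> r" "0 \<le> s" "0 \<le> t"
  shows "(u * r + v * s + w * t) powr p \<le> u * r powr p + v * s powr p + w * t powr p"
proof (cases "u * r + v * s + w * t = 0")
  case True
  then show ?thesis using w by simp
next
  case False
  define m where "m = u * r + v * s + w * t"
  have m: "0 < m" using False w t by (simp add: m_def order.not_eq_order_implies_strict)
  have "m powr p = u * (m powr p * (1 + p * (r / m - 1))) + v * (m powr p * (1 + p * (s / m - 1)))
      + w * (m powr p * (1 + p * (t / m - 1)))"
  proof -
    have "u * (1 + p * (r / m - 1)) + v * (1 + p * (s / m - 1)) + w * (1 + p * (t / m - 1))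
       = (u + v + w) + p * ((u * r + v * s + w * t) / m - (u + v + w))"
      by (simp add: add_divide_distrib algebra_simps)
    also have "\<dots> = 1" using w m by (simp flip: m_def)
    finally have "m powr p = m powr p *
      (u * (1 + p * (r / m - 1)) + v * (1 + p * (s / m - 1)) + w * (1 + p * (t / m - 1)))" by simp
    then show ?thesis by (simp add: algebra_simps)
  qed
  also have "\<dots> \<le> u * r powr p + v * s powr p + w * t powr p"
    using w t m p by (intro add_mono mult_left_mono powr_above_tangent) auto
  finally show ?thesis by (simp add: m_def)
qed

text \<open>The sum \<open>a + b + c\<close> is \<open>S = A + B + C\<close> times the mean of
  \<open>a / A\<close>, \<open>b / B\<close>, \<open>c / C\<close> with weights
  \<open>A / S\<close>, \<open>B / S\<close>, \<open>C / S\<close>, so Jensen's inequality applies.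
  The bound is linear in the p-th powers, hence ready to be integrated.\<close>

lemma powr_add3_le:
  fixes p :: real
  assumes p: "1 \<le> p" and pos: "0 < A" "0 < B" "0 < C" and nn: "0 \<le> a" "0 \<le> b" "0 \<le> c"
  shows "(a + b + c) powr p \<le> (A + B + C) powr (p - 1) *
    (A * (a / A) powr p + B * (b / B) powr p + C * (c / C) powr p)"
proof -
  define S where "S = A + B + C"
  have S: "0 < S" using pos by (simp add: S_def)
  have "(a + b + c) powr p = (S * (A / S * (a / A) + B / S * (b / B) + C / S * (c / C))) powr p"
    using S pos by (simp add: distrib_left)
  also have "\<dots> = S powr p * (A / S * (a / A) + B / S * (b / B) + C / S * (c / C)) powr p"
    by (rule powr_mult)
  also have "\<dots> \<le> S powr p * (A / S * (a / A) powr p + B / S * (b / B) powr p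
      + C / S * (c / C) powr p)"
    using S pos nn p
    by (intro mult_left_mono powr_weighted_mean3_le)
      (auto simp: S_def simp flip: add_divide_distrib)
  also have "\<dots> = S powr p / S * (A * (a / A) powr p + B * (b / B) powr p + C * (c / C) powr p)"
    by (simp add: add_divide_distrib algebra_simps)
  also have "S powr p / S = S powr (p - 1)" using S by (simp add: powr_diff)
  finally show ?thesis by (simp add: S_def)
qed

text \<open>Since \<open>(f x / A) powr p\<close> and \<open>(g x / B) powr p\<close> have integral
  at most 1, integrating \<open>powr_add3_le\<close> gives at most
  \<open>S powr (p - 1) * S\<close>. The term in \<open>h\<close> is replaced by a constant before
  integrating, through the almost sure bound \<open>C\<close>.\<close>

lemma (in prob_space) minkowski3_nn_integral:
  fixes f g h k :: "'a \<Rightarrow> real"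
  assumes p: "1 \<le> p" and pos: "0 < A" "0 < B" "0 < C"
    and [measurable]: "f \<in> borel_measurable M" "g \<in> borel_measurable M"
    and nn: "\<And>x. 0 \<le> f x" "\<And>x. 0 \<le> g x" "\<And>x. 0 \<le> h x" "\<And>x. 0 \<le> k x"
    and f: "(\<integral>\<^sup>+ x. ennreal (f x powr p) \<partial>M) \<le> ennreal (A powr p)"
    and g: "(\<integral>\<^sup>+ x. ennreal (g x powr p) \<partial>M) \<le> ennreal (B powr p)"
    and h: "AE x in M. h x \<le> C"
    and k: "\<And>x. k x \<le> f x + g x + h x"
  shows "(\<integral>\<^sup>+ x. ennreal (k x powr p) \<partial>M) \<le> ennreal ((A + B + C) powr p)"
proof -
  define S where "S = A + B + C"
  have S: "0 < S" using pos by (simp add: S_def)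
  let ?K = "S powr (p - 1)"
  \<comment> \<open>Chosen so that \<open>a * A powr p = ?K * A\<close> and
    \<open>b * B powr p = ?K * B\<close>.\<close>
  define a b where "a = ?K * A / A powr p" and "b = ?K * B / B powr p"
  have ab: "0 \<le> a" "0 \<le> b" using pos by (auto simp: a_def b_def)
  have "AE x in M. ennreal (k x powr p) \<le>
      ennreal a * ennreal (f x powr p) + ennreal b * ennreal (g x powr p) + ennreal (?K * C)"
    using h
  proof eventually_elim
    case (elim x)
    have "k x powr p \<le> (f x + g x + h x) powr p"
      using nn k p by (intro powr_mono2) auto
    also have "\<dots> \<le> ?K * (A * (f x / A) powr p + B * (g x / B) powr p + C * (h x / C) powr p)"
      unfolding S_def using p pos nn by (intro powr_add3_le) auto
    also have "\<dots> \<le> ?K * (A * (f x / A) powr p + B * (g x / B) powr p + C * 1)"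
      using elim nn pos p by (intro mult_left_mono add_mono order.refl powr_le1) auto
    also have "\<dots> = a * f x powr p + b * g x powr p + ?K * C"
      using pos nn by (simp add: a_def b_def powr_divide algebra_simps)
    finally have "ennreal (k x powr p) \<le> ennreal (a * f x powr p + b * g x powr p + ?K * C)"
      by (rule ennreal_leI)
    then show ?case using ab pos by (simp add: ennreal_mult)
  qed
  then have "(\<integral>\<^sup>+ x. ennreal (k x powr p) \<partial>M) \<le> (\<integral>\<^sup>+ x. ennreal a * ennreal (f x powr p)
      + ennreal b * ennreal (g x powr p) + ennreal (?K * C) \<partial>M)"
    by (rule nn_integral_mono_AE)
  also have "\<dots> = ennreal a * (\<integral>\<^sup>+ x. ennreal (f x powr p) \<partial>M)
      + ennreal b * (\<integral>\<^sup>+ x. ennreal (g x powr p) \<partial>M) + ennreal (?K * C)"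
    by (simp add: nn_integral_add nn_integral_cmult emeasure_space_1)
  also have "\<dots> \<le> ennreal a * ennreal (A powr p) + ennreal b * ennreal (B powr p)
      + ennreal (?K * C)"
    using f g by (intro add_mono mult_left_mono) auto
  also have "\<dots> = ennreal (a * A powr p + b * B powr p + ?K * C)"
    using ab pos by (simp add: ennreal_mult)
  also have "a * A powr p + b * B powr p + ?K * C = ?K * S"
    using pos by (simp add: a_def b_def S_def algebra_simps)
  also have "?K * S = S powr p" using S by (simp add: powr_diff)
  finally show ?thesis by (simp add: S_def)
qed

section \<open>Measures determined by bounded continuous functions\<close>

text \<open>The indicator of a closed set is a pointwise limit of bounded continuous functions, and
  the closed sets form an intersection-stable generator. As couplings are defined by test functions,
  this is what turns their marginals into equalities of measures.\<close>

lemma measure_eqI_bounded_continuous: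
  fixes M N :: "'a::metric_space measure"
  assumes M: "finite_measure M" "sets M = sets borel"
    and N: "finite_measure N" "sets N = sets borel"
    and eq: "\<And>\<phi> :: 'a \<Rightarrow> real. continuous_on UNIV \<phi> \<Longrightarrow> bounded (range \<phi>) \<Longrightarrow>
      (\<integral>x. \<phi> x \<partial>M) = (\<integral>x. \<phi> x \<partial>N)"
  shows "M = N"
proof -
  have closed_eq: "emeasure M A = emeasure N A" if A: "closed A" for A
  \<comment> \<open>The empty set is separated because \<open>infdist x {}\<close> is 0 by
    convention, which would make the cut-offs below constantly 1.\<close>
  proof (cases "A = {}")
    case False
    \<comment> \<open>Continuous cut-offs: 1 on \<open>A\<close> and, for positive \<open>n\<close>,
      0 at distance \<open>1 / n\<close> or more from \<open>A\<close>.\<close>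
    define \<phi> where "\<phi> n x = max 0 (1 - real n * infdist x A)" for n x
    have cont: "continuous_on UNIV (\<phi> n)" for n
      unfolding \<phi>_def by (intro continuous_intros)
    have range: "0 \<le> \<phi> n x" "\<phi> n x \<le> 1" for n x
      using infdist_nonneg[of x A] by (auto simp: \<phi>_def)
    have bdd: "bounded (range (\<phi> n))" for n
      unfolding bounded_iff using range by (intro exI[of _ 1]) auto
    have lim: "(\<lambda>n. \<phi> n x) \<longlonglongrightarrow> indicat_real A x" for x
    proof (cases "x \<in> A")
      case True
      then show ?thesis by (simp add: \<phi>_def)
    next
      case xA: False
      then have d: "0 < infdist x A" using A False by (simp add: infdist_pos_not_in_closed)
      obtain k where k: "1 < real k * infdist x A" using d reals_Archimedean3 by blast
      have "\<phi> n x = 0" if "k \<le> n" for n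
      proof -
        have "real k * infdist x A \<le> real n * infdist x A"
          using that d by (intro mult_right_mono) auto
        then show ?thesis using k by (simp add: \<phi>_def)
      qed
      then have "eventually (\<lambda>n. \<phi> n x = indicat_real A x) sequentially"
        using xA by (auto simp: eventually_sequentially)
      then show ?thesis by (rule tendsto_eventually)
    qed
    have conv: "(\<lambda>n. \<integral>x. \<phi> n x \<partial>L) \<longlonglongrightarrow> measure L A"
      if "finite_measure L" and sL: "sets L = sets borel" for L :: "'a measure"
    proof -
      interpret finite_measure L by fact
      note sL[measurable_cong]
      have [measurable]: "\<phi> n \<in> borel_measurable borel" for n
        by (intro borel_measurable_continuous_onI cont)
      have [measurable]: "A \<in> sets borel" using A by simp
      have "(\<lambda>n. \<integral>x. \<phi> n x \<partial>L) \<longlonglongrightarrow> (\<integral>x. indicat_real A x \<partial>L)"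
        using range lim by (intro integral_dominated_convergence[where w="\<lambda>_. 1"]) auto
      then show ?thesis using sL A by simp
    qed
    have "measure M A = measure N A"
      using LIMSEQ_unique[OF conv[OF M]] conv[OF N] eq[OF cont bdd] by simp
    then show ?thesis using M N by (simp add: finite_measure.emeasure_eq_measure)
  qed simp
  have gen: "sets borel = sigma_sets UNIV (Collect closed :: 'a set set)"
    by (simp add: borel_eq_closed)
  show ?thesis
  proof (rule measure_eqI_generator_eq[where E="Collect closed" and A="\<lambda>_. UNIV" and \<Omega>=UNIV])
    show "Int_stable (Collect closed :: 'a set set)" by (auto simp: Int_stable_def)
  qed (use M N gen closed_eq in \<open>auto simp: finite_measure.emeasure_finite\<close>)
qed

section \<open>Gluing along a countable-valued label\<close>

text \<open>Under \<open>\<gamma>\<close> the two components are independent given their common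
  label. Integrating the weight over one variable gives \<open>inverse (m n) * m n\<close>, which is
  1 on every cell of positive mass, so both marginals survive.\<close>

lemma countable_gluing:
  fixes f :: "'a \<Rightarrow> 'c::countable" and g :: "'b \<Rightarrow> 'c"
  assumes "prob_space \<rho>" "prob_space \<sigma>"
    and f[measurable]: "f \<in> measurable \<rho> (count_space UNIV)"
    and g[measurable]: "g \<in> measurable \<sigma> (count_space UNIV)"
    and eq: "distr \<rho> (count_space UNIV) f = distr \<sigma> (count_space UNIV) g"
  obtains \<gamma> where "sets \<gamma> = sets (\<rho> \<Otimes>\<^sub>M \<sigma>)" "distr \<gamma> \<rho> fst = \<rho>" "distr \<gamma> \<sigma> snd = \<sigma>"
    "AE z in \<gamma>. f (fst z) = g (snd z)"
proof -
  interpret \<rho>: prob_space \<rho> by fact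
  interpret \<sigma>: prob_space \<sigma> by fact
  interpret pair_prob_space \<rho> \<sigma> ..
  define m where "m n = emeasure \<rho> (f -` {n} \<inter> space \<rho>)" for n
  have m': "m n = emeasure \<sigma> (g -` {n} \<inter> space \<sigma>)" for n
    using arg_cong[OF eq, of "\<lambda>L. emeasure L {n}"] by (simp add: m_def emeasure_distr)
  have m_fin: "m n \<noteq> \<top>" for n by (simp add: m_def)
  \<comment> \<open>On a cell of mass 0 the weight is infinite, since \<open>inverse 0\<close> is
    infinity in \<open>ennreal\<close>; \<open>pos1\<close> and \<open>pos2\<close> show that such
    cells do not matter.\<close>
  define w where "w z = (if f (fst z) = g (snd z) then inverse (m (f (fst z))) else 0)" for z
  have [measurable]: "w \<in> borel_measurable (\<rho> \<Otimes>\<^sub>M \<sigma>)" unfolding w_def by measurable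
  define \<gamma> where "\<gamma> = density (\<rho> \<Otimes>\<^sub>M \<sigma>) w"
  have s: "sets \<gamma> = sets (\<rho> \<Otimes>\<^sub>M \<sigma>)" by (simp add: \<gamma>_def)
  have pos1: "AE x in \<rho>. m (f x) \<noteq> 0"
  proof -
    have "AE x in \<rho>. f x = n \<longrightarrow> m n \<noteq> 0" for n
    proof (cases "m n = 0")
      case True
      show ?thesis
        by (rule AE_I[where N="f -` {n} \<inter> space \<rho>"]) (use True in \<open>auto simp: m_def\<close>)
    qed simp
    \<comment> \<open>Countability of the label type enters here: the null cells have a null
      union.\<close>
    then have "AE x in \<rho>. \<forall>n. f x = n \<longrightarrow> m n \<noteq> 0" by (intro AE_all_countable[THEN iffD2] allI)
    then show ?thesis by eventually_elim auto
  qed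
  have pos2: "AE y in \<sigma>. m (g y) \<noteq> 0"
  proof -
    have "AE x in \<sigma>. g x = n \<longrightarrow> m n \<noteq> 0" for n
    proof (cases "m n = 0")
      case True
      show ?thesis
        by (rule AE_I[where N="g -` {n} \<inter> space \<sigma>"]) (use True in \<open>auto simp: m'\<close>)
    qed simp
    then have "AE x in \<sigma>. \<forall>n. g x = n \<longrightarrow> m n \<noteq> 0" by (intro AE_all_countable[THEN iffD2] allI)
    then show ?thesis by eventually_elim auto
  qed
  \<comment> \<open>For fixed \<open>x\<close> the weight is constant on the cell of
    \<open>g\<close> with label \<open>f x\<close>, whose mass under \<open>\<sigma>\<close> is also
    \<open>m (f x)\<close>.\<close>
  have int2: "(\<integral>\<^sup>+ y. w (x, y) \<partial>\<sigma>) = inverse (m (f x)) * m (f x)" for x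
  proof -
    have "(\<integral>\<^sup>+ y. w (x, y) \<partial>\<sigma>) =
        (\<integral>\<^sup>+ y. inverse (m (f x)) * indicator (g -` {f x} \<inter> space \<sigma>) y \<partial>\<sigma>)"
      by (intro nn_integral_cong) (auto simp: w_def split: split_indicator)
    then show ?thesis by (simp add: nn_integral_cmult_indicator m')
  qed
  have int1: "(\<integral>\<^sup>+ x. w (x, y) \<partial>\<rho>) = inverse (m (g y)) * m (g y)" for y
  proof -
    have "(\<integral>\<^sup>+ x. w (x, y) \<partial>\<rho>) =
        (\<integral>\<^sup>+ x. inverse (m (g y)) * indicator (f -` {g y} \<inter> space \<rho>) x \<partial>\<rho>)"
      by (intro nn_integral_cong) (auto simp: w_def split: split_indicator)
    then show ?thesis by (simp add: nn_integral_cmult_indicator m_def)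
  qed
  have inv: "inverse (m n) * m n = 1" if "m n \<noteq> 0" for n
    using that m_fin[of n] ennreal_divide_self[of "m n"]
    by (simp add: divide_ennreal_def mult.commute less_top)
  have "distr \<gamma> \<rho> fst = \<rho>"
  proof (rule measure_eqI)
    fix X assume "X \<in> sets (distr \<gamma> \<rho> fst)"
    then have X[measurable]: "X \<in> sets \<rho>" by simp
    have "emeasure (distr \<gamma> \<rho> fst) X = (\<integral>\<^sup>+ u. indicator X u \<partial>distr \<gamma> \<rho> fst)"
      by simp
    also have "\<dots> = (\<integral>\<^sup>+ z. w z * indicator X (fst z) \<partial>(\<rho> \<Otimes>\<^sub>M \<sigma>))"
      unfolding \<gamma>_def by (subst nn_integral_distr) (simp_all add: nn_integral_density)
    also have "\<dots> = (\<integral>\<^sup>+ x. (\<integral>\<^sup>+ y. w (x, y) * indicator X x \<partial>\<sigma>) \<partial>\<rho>)"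
      by (subst \<sigma>.nn_integral_fst[symmetric]) auto
    also have "\<dots> = (\<integral>\<^sup>+ x. indicator X x \<partial>\<rho>)"
      using pos1 by (intro nn_integral_cong_AE, eventually_elim)
        (auto simp: int2 inv split: split_indicator)
    finally show "emeasure (distr \<gamma> \<rho> fst) X = emeasure \<rho> X" by simp
  qed simp
  moreover have "distr \<gamma> \<sigma> snd = \<sigma>"
  proof (rule measure_eqI)
    fix X assume "X \<in> sets (distr \<gamma> \<sigma> snd)"
    then have X[measurable]: "X \<in> sets \<sigma>" by simp
    have "emeasure (distr \<gamma> \<sigma> snd) X = (\<integral>\<^sup>+ u. indicator X u \<partial>distr \<gamma> \<sigma> snd)"
      by simp
    also have "\<dots> = (\<integral>\<^sup>+ z. w z * indicator X (snd z) \<partial>(\<rho> \<Otimes>\<^sub>M \<sigma>))"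
      unfolding \<gamma>_def by (subst nn_integral_distr) (simp_all add: nn_integral_density)
    also have "\<dots> = (\<integral>\<^sup>+ y. (\<integral>\<^sup>+ x. w (x, y) * indicator X y \<partial>\<rho>) \<partial>\<sigma>)"
      by (subst nn_integral_snd[symmetric]) auto
    also have "\<dots> = (\<integral>\<^sup>+ y. indicator X y \<partial>\<sigma>)"
      using pos2 by (intro nn_integral_cong_AE, eventually_elim)
        (auto simp: int1 inv split: split_indicator)
    finally show "emeasure (distr \<gamma> \<sigma> snd) X = emeasure \<sigma> X" by simp
  qed simp
  moreover have "AE z in \<gamma>. f (fst z) = g (snd z)"
    unfolding \<gamma>_def by (subst AE_density) (auto simp: w_def)
  ultimately show ?thesis using s that by blast
qed

section \<open>A countable Borel partition into small cells\<close>

text \<open>Label \<open>x\<close> by the first member of a dense sequence within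
  \<open>e / 2\<close> of it; a fiber then lies in a ball of radius \<open>e / 2\<close>. The
  partition is encoded by its labelling function.\<close>

lemma borel_small_fibers:
  fixes e :: real
  assumes "0 < e"
  obtains f :: "'a::{metric_space, second_countable_topology} \<Rightarrow> nat"
  where "f \<in> measurable borel (count_space UNIV)" "\<And>x y. f x = f y \<Longrightarrow> dist x y \<le> e"
proof -
  obtain D :: "'a set" where D: "countable D" "\<And>X. open X \<Longrightarrow> X \<noteq> {} \<Longrightarrow> \<exists>d\<in>D. d \<in> X"
    by (rule countable_dense_setE) blast
  have "D \<noteq> {}" using D(2)[of UNIV] by auto
  define d where "d = from_nat_into D"
  define f where "f x = (LEAST n. dist x (d n) < e / 2)" for x
  have ex: "\<exists>n. dist x (d n) < e / 2" for x
  proof -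
    obtain y where "y \<in> D" "y \<in> ball x (e / 2)" using D(2)[of "ball x (e / 2)"] assms by auto
    then show ?thesis using from_nat_into_surj[OF D(1)] by (auto simp: d_def)
  qed
  have close: "dist x (d (f x)) < e / 2" for x
    unfolding f_def by (rule LeastI_ex) (rule ex)
  show thesis
  proof
    show "f \<in> measurable borel (count_space UNIV)" unfolding f_def by measurable
    show "dist x y \<le> e" if "f x = f y" for x y
      using close[of x] close[of y] that dist_triangle2[of x y "d (f x)"] by simp
  qed
qed

section \<open>Marginals of couplings\<close>

lemma couplings_integral_add:
  fixes \<phi> \<psi> :: "'a::polish_space \<Rightarrow> real"
  assumes "\<rho> \<in> couplings \<mu> \<nu>" "continuous_on UNIV \<phi>" "bounded (range \<phi>)"
    "continuous_on UNIV \<psi>" "bounded (range \<psi>)"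
  shows "(\<integral>z. \<phi> (fst z) + \<psi> (snd z) \<partial>\<rho>) = (\<integral>x. \<phi> x \<partial>\<mu>) + (\<integral>y. \<psi> y \<partial>\<nu>)"
  using assms by (simp add: couplings_def)

lemma coupling_integral_fst:
  assumes "\<rho> \<in> couplings \<mu> \<nu>" "continuous_on UNIV \<phi>" "bounded (range \<phi>)"
  shows "(\<integral>z. \<phi> (fst z) \<partial>\<rho>) = (\<integral>x. \<phi> x \<partial>\<mu> :: real)"
proof -
  \<comment> \<open>Taking 0 as the other test function isolates one marginal.\<close>
  have "(\<integral>z. \<phi> (fst z) + (\<lambda>_. 0) (snd z) \<partial>\<rho>) = (\<integral>x. \<phi> x \<partial>\<mu>) + (\<integral>y. (\<lambda>_. 0) y \<partial>\<nu>)"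
    using assms by (intro couplings_integral_add) auto
  then show ?thesis by simp
qed

lemma coupling_integral_snd:
  assumes "\<rho> \<in> couplings \<mu> \<nu>" "continuous_on UNIV \<psi>" "bounded (range \<psi>)"
  shows "(\<integral>z. \<psi> (snd z) \<partial>\<rho>) = (\<integral>y. \<psi> y \<partial>\<nu> :: real)"
proof -
  have "(\<integral>z. (\<lambda>_. 0) (fst z) + \<psi> (snd z) \<partial>\<rho>) = (\<integral>x. (\<lambda>_. 0) x \<partial>\<mu>) + (\<integral>y. \<psi> y \<partial>\<nu>)"
    using assms by (intro couplings_integral_add) auto
  then show ?thesis by simp
qed

text \<open>Both marginals integrate every bounded continuous function to its integral against
  \<open>\<mu>\<close>.\<close>

lemma couplings_common_marginal:
  fixes \<rho> \<sigma> :: "('a::polish_space \<times> 'a) measure"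
  assumes \<rho>: "\<rho> \<in> couplings lam \<mu>" and \<sigma>: "\<sigma> \<in> couplings \<mu> \<nu>"
  shows "distr \<rho> borel snd = distr \<sigma> borel fst"
proof -
  have pr: "prob_space \<rho>" "prob_space \<sigma>"
    and [measurable_cong]: "sets \<rho> = sets (borel \<Otimes>\<^sub>M borel)" "sets \<sigma> = sets (borel \<Otimes>\<^sub>M borel)"
    using \<rho> \<sigma> unfolding couplings_def borel_probs_def borel_prod by simp_all
  show ?thesis
  proof (rule measure_eqI_bounded_continuous)
    show "finite_measure (distr \<rho> borel snd)" "finite_measure (distr \<sigma> borel fst)"
      using pr by (auto intro!: finite_measure.finite_measure_distr simp: prob_space_def)
    fix \<phi> :: "'a \<Rightarrow> real" assume c: "continuous_on UNIV \<phi>" and b: "bounded (range \<phi>)"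
    have [measurable]: "\<phi> \<in> borel_measurable borel" using c by (rule borel_measurable_continuous_onI)
    show "(\<integral>x. \<phi> x \<partial>distr \<rho> borel snd) = (\<integral>x. \<phi> x \<partial>distr \<sigma> borel fst)"
      by (simp add: integral_distr coupling_integral_snd[OF \<rho> c b] coupling_integral_fst[OF \<sigma> c b])
  qed auto
qed

section \<open>Triangle inequality for the transport cost up to a small error\<close>

text \<open>Read a point of the glued measure \<open>\<gamma>\<close> as
  \<open>((x, y), (y', z))\<close>, with \<open>(x, y)\<close> distributed as \<open>\<rho>\<close>
  and \<open>(y', z)\<close> as \<open>\<sigma>\<close>. The law of \<open>(x, z)\<close> is a
  coupling whose cost is bounded by Minkowski's inequality for the distances from \<open>x\<close>
  to \<open>y\<close>, from \<open>y'\<close> to \<open>z\<close> and from \<open>y\<close> to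
  \<open>y'\<close>.\<close>

lemma transport_cost_triangle_approx:
  fixes \<rho> \<sigma> :: "('a::polish_space \<times> 'a) measure"
  assumes p: "1 \<le> p" and pos: "0 < A" "0 < B" "0 < e"
    and \<rho>: "\<rho> \<in> couplings lam \<mu>" and \<sigma>: "\<sigma> \<in> couplings \<mu> \<nu>"
    and A: "(\<integral>\<^sup>+ z. ennreal (dist (fst z) (snd z) powr p) \<partial>\<rho>) \<le> ennreal (A powr p)"
    and B: "(\<integral>\<^sup>+ z. ennreal (dist (fst z) (snd z) powr p) \<partial>\<sigma>) \<le> ennreal (B powr p)"
  shows "transport_cost p lam \<nu> \<le> ennreal ((A + B + e) powr p)"
proof -
  have pr: "prob_space \<rho>" "prob_space \<sigma>" and s: "sets \<rho> = sets borel" "sets \<sigma> = sets borel"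
    using \<rho> \<sigma> by (auto simp: couplings_def borel_probs_def)
  have [measurable_cong]: "sets \<rho> = sets (borel \<Otimes>\<^sub>M borel)" "sets \<sigma> = sets (borel \<Otimes>\<^sub>M borel)"
    using s unfolding borel_prod by simp_all
  obtain f :: "'a \<Rightarrow> nat" where f[measurable]: "f \<in> measurable borel (count_space UNIV)"
    and small: "\<And>x y. f x = f y \<Longrightarrow> dist x y \<le> e"
    using borel_small_fibers[OF pos(3)] by blast
  \<comment> \<open>The common marginal is pushed forward by \<open>f\<close>: the cell labels of
    the two intermediate points have the same law.\<close>
  have "distr (distr \<rho> borel snd) (count_space UNIV) f = distr (distr \<sigma> borel fst) (count_space UNIV) f"
    using couplings_common_marginal[OF \<rho> \<sigma>] by simp
  then have "distr \<rho> (count_space UNIV) (\<lambda>z. f (snd z)) = distr \<sigma> (count_space UNIV) (\<lambda>z. f (fst z))"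
    by (simp add: distr_distr comp_def)
  then obtain \<gamma> where s\<gamma>: "sets \<gamma> = sets (\<rho> \<Otimes>\<^sub>M \<sigma>)"
    and \<gamma>1: "distr \<gamma> \<rho> fst = \<rho>" and \<gamma>2: "distr \<gamma> \<sigma> snd = \<sigma>"
    and ae: "AE z in \<gamma>. f (snd (fst z)) = f (fst (snd z))"
    by (rule countable_gluing[OF pr, rotated 2]) auto
  note s\<gamma>[measurable_cong]
  \<comment> \<open>The total mass of \<open>\<gamma>\<close> is read off from its image
    \<open>\<rho>\<close>.\<close>
  interpret \<gamma>: prob_space \<gamma>
    by (rule prob_space_distrD[of fst \<gamma> \<rho>]) (use \<gamma>1 pr in auto)
  let ?x = "\<lambda>z. fst (fst z)" and ?z = "\<lambda>z. snd (snd z)"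
  define \<tau> where "\<tau> = distr \<gamma> borel (\<lambda>z. (?x z, ?z z))"
  have [measurable]: "(\<lambda>z. (?x z, ?z z)) \<in> measurable \<gamma> borel"
    unfolding borel_prod[symmetric] by measurable
  have [measurable]: "(\<lambda>z. dist (fst z) (snd z) powr p)
      \<in> borel_measurable (borel :: ('a \<times> 'a) measure)"
    unfolding borel_prod[symmetric] by measurable
  have "\<tau> \<in> couplings lam \<nu>"
  proof -
    have "(\<integral>z. \<phi> (fst z) + \<psi> (snd z) \<partial>\<tau>) = (\<integral>x. \<phi> x \<partial>lam) + (\<integral>y. \<psi> y \<partial>\<nu>)"
      if c: "continuous_on UNIV \<phi>" "continuous_on UNIV \<psi>"
        and b: "bounded (range \<phi>)" "bounded (range \<psi>)" for \<phi> \<psi> :: "'a \<Rightarrow> real"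
    proof -
      obtain K L where K: "\<And>x. norm (\<phi> x) \<le> K" and L: "\<And>x. norm (\<psi> x) \<le> L"
        using b by (auto simp: bounded_iff)
      have [measurable]: "\<phi> \<in> borel_measurable borel" "\<psi> \<in> borel_measurable borel"
        using c by (auto intro: borel_measurable_continuous_onI)
      have m: "(\<lambda>z. \<phi> (fst z)) \<in> borel_measurable (borel :: ('a \<times> 'a) measure)"
        "(\<lambda>z. \<psi> (snd z)) \<in> borel_measurable (borel :: ('a \<times> 'a) measure)"
        unfolding borel_prod[symmetric] by measurable
      have "(\<integral>z. \<phi> (fst z) + \<psi> (snd z) \<partial>\<tau>) = (\<integral>z. \<phi> (?x z) + \<psi> (?z z) \<partial>\<gamma>)"
        unfolding \<tau>_def by (subst integral_distr) (use m in auto)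
      also have "\<dots> = (\<integral>z. \<phi> (?x z) \<partial>\<gamma>) + (\<integral>z. \<psi> (?z z) \<partial>\<gamma>)"
        by (intro Bochner_Integration.integral_add \<gamma>.integrable_const_bound[where B=K]
            \<gamma>.integrable_const_bound[where B=L]) (use K L in auto)
      \<comment> \<open>Each summand depends on one component of \<open>\<gamma>\<close> only, so it
        is an integral against \<open>\<rho>\<close> or \<open>\<sigma>\<close>.\<close>
      also have "(\<integral>z. \<phi> (?x z) \<partial>\<gamma>) = (\<integral>u. \<phi> (fst u) \<partial>distr \<gamma> \<rho> fst)"
        by (rule integral_distr[symmetric]) auto
      also have "(\<integral>z. \<psi> (?z z) \<partial>\<gamma>) = (\<integral>u. \<psi> (snd u) \<partial>distr \<gamma> \<sigma> snd)"
        by (rule integral_distr[symmetric]) auto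
      finally show ?thesis
        using coupling_integral_fst[OF \<rho> c(1) b(1)] coupling_integral_snd[OF \<sigma> c(2) b(2)]
        by (simp add: \<gamma>1 \<gamma>2)
    qed
    moreover have "prob_space \<tau>" unfolding \<tau>_def by (rule \<gamma>.prob_space_distr) simp
    ultimately show ?thesis by (auto simp: couplings_def borel_probs_def \<tau>_def)
  qed
  then have "transport_cost p lam \<nu> \<le> (\<integral>\<^sup>+ z. ennreal (dist (fst z) (snd z) powr p) \<partial>\<tau>)"
    unfolding transport_cost_def by (rule INF_lower)
  also have "\<dots> = (\<integral>\<^sup>+ z. ennreal (dist (?x z) (?z z) powr p) \<partial>\<gamma>)"
    unfolding \<tau>_def by (subst nn_integral_distr) auto
  also have "\<dots> \<le> ennreal ((A + B + e) powr p)"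
  proof (rule \<gamma>.minkowski3_nn_integral[where f="\<lambda>z. dist (fst (fst z)) (snd (fst z))"
        and g="\<lambda>z. dist (fst (snd z)) (snd (snd z))" and h="\<lambda>z. dist (snd (fst z)) (fst (snd z))"])
    have "(\<integral>\<^sup>+ z. ennreal (dist (fst (fst z)) (snd (fst z)) powr p) \<partial>\<gamma>)
        = (\<integral>\<^sup>+ u. ennreal (dist (fst u) (snd u) powr p) \<partial>distr \<gamma> \<rho> fst)"
      by (subst nn_integral_distr) auto
    then show "(\<integral>\<^sup>+ z. ennreal (dist (fst (fst z)) (snd (fst z)) powr p) \<partial>\<gamma>) \<le> ennreal (A powr p)"
      using A by (simp add: \<gamma>1)
    have "(\<integral>\<^sup>+ z. ennreal (dist (fst (snd z)) (snd (snd z)) powr p) \<partial>\<gamma>)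
        = (\<integral>\<^sup>+ u. ennreal (dist (fst u) (snd u) powr p) \<partial>distr \<gamma> \<sigma> snd)"
      by (subst nn_integral_distr) auto
    then show "(\<integral>\<^sup>+ z. ennreal (dist (fst (snd z)) (snd (snd z)) powr p) \<partial>\<gamma>) \<le> ennreal (B powr p)"
      using B by (simp add: \<gamma>2)
    show "AE z in \<gamma>. dist (snd (fst z)) (fst (snd z)) \<le> e"
      using ae by eventually_elim (rule small)
    show "dist (?x z) (?z z) \<le> dist (fst (fst z)) (snd (fst z)) + dist (fst (snd z)) (snd (snd z))
        + dist (snd (fst z)) (fst (snd z))" for z :: "('a \<times> 'a) \<times> ('a \<times> 'a)"
      using dist_triangle[of "?x z" "?z z" "snd (fst z)"]
        dist_triangle[of "snd (fst z)" "?z z" "fst (snd z)"] by linarith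
  qed (use p pos in auto)
  finally show ?thesis .
qed

section \<open>From transport cost to Wasserstein distance\<close>

lemma wasserstein_nonneg: "0 \<le> wasserstein p \<mu> \<nu>"
  by (simp add: wasserstein_def)

text \<open>A number strictly above an infimum is strictly above one of its members; the strict
  inequality passes from distance to cost by monotonicity of the p-th power.\<close>

lemma exists_coupling_cost_le:
  fixes \<mu> \<nu> :: "('a::polish_space) measure"
  assumes p: "1 \<le> p" and \<mu>\<nu>: "\<mu> \<in> borel_probs_moment p" "\<nu> \<in> borel_probs_moment p"
    and A: "wasserstein p \<mu> \<nu> < A"
  obtains \<rho> where "\<rho> \<in> couplings \<mu> \<nu>"
    "(\<integral>\<^sup>+ z. ennreal (dist (fst z) (snd z) powr p) \<partial>\<rho>) \<le> ennreal (A powr p)"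
proof -
  have "enn2real (transport_cost p \<mu> \<nu>) = wasserstein p \<mu> \<nu> powr p"
    using p by (simp add: wasserstein_def powr_powr)
  also have "\<dots> < A powr p"
    using A p wasserstein_nonneg[of p \<mu> \<nu>] by (intro powr_less_mono2) auto
  finally have "ennreal (enn2real (transport_cost p \<mu> \<nu>)) < ennreal (A powr p)"
    by (simp add: ennreal_less_iff)
  \<comment> \<open>\<open>enn2real\<close> sends infinity to 0, so finiteness of the cost is what
    allows the return to \<open>ennreal\<close>.\<close>
  then have "transport_cost p \<mu> \<nu> < ennreal (A powr p)"
    using transport_cost_finite[OF p \<mu>\<nu>] by simp
  then show thesis
    unfolding transport_cost_def INF_less_iff using that by (auto intro: less_imp_le)
qed

theorem mainTheorem1:
  fixes p :: real and lam \<mu> \<nu> :: "('a::polish_space) measure"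
  assumes "1 \<le> p"
    and "lam \<in> borel_probs_moment p"
    and "\<mu> \<in> borel_probs_moment p"
    and "\<nu> \<in> borel_probs_moment p"
  shows "wasserstein p lam \<nu> \<le> wasserstein p lam \<mu> + wasserstein p \<mu> \<nu>"
proof (rule field_le_epsilon)
  fix \<epsilon> :: real assume "0 < \<epsilon>"
  \<comment> \<open>One third of \<open>\<epsilon>\<close> goes to each near-optimal coupling and
    one to the cell diameter. The margin also keeps \<open>A\<close> and \<open>B\<close> positive
    when a distance vanishes, as Minkowski's inequality divides by them.\<close>
  define e A B where "e = \<epsilon> / 3" and "A = wasserstein p lam \<mu> + e" and "B = wasserstein p \<mu> \<nu> + e"
  have e: "0 < e" using \<open>0 < \<epsilon>\<close> by (simp add: e_def)
  have pos: "0 < A" "0 < B"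
    using e wasserstein_nonneg[of p lam \<mu>] wasserstein_nonneg[of p \<mu> \<nu>] by (auto simp: A_def B_def)
  obtain \<rho> where \<rho>: "\<rho> \<in> couplings lam \<mu>"
    "(\<integral>\<^sup>+ z. ennreal (dist (fst z) (snd z) powr p) \<partial>\<rho>) \<le> ennreal (A powr p)"
    using exists_coupling_cost_le[of p lam \<mu> A] assms e by (auto simp: A_def)
  obtain \<sigma> where \<sigma>: "\<sigma> \<in> couplings \<mu> \<nu>"
    "(\<integral>\<^sup>+ z. ennreal (dist (fst z) (snd z) powr p) \<partial>\<sigma>) \<le> ennreal (B powr p)"
    using exists_coupling_cost_le[of p \<mu> \<nu> B] assms e by (auto simp: B_def)
  have "enn2real (transport_cost p lam \<nu>) \<le> (A + B + e) powr p"
    using transport_cost_triangle_approx[OF assms(1) pos e \<rho>(1) \<sigma>(1) \<rho>(2) \<sigma>(2)]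
    by (intro enn2real_leI) auto
  then have "wasserstein p lam \<nu> \<le> ((A + B + e) powr p) powr (1 / p)"
    unfolding wasserstein_def using assms(1) by (intro powr_mono2) auto
  also have "\<dots> = A + B + e" using assms(1) pos e by (simp add: powr_powr)
  finally show "wasserstein p lam \<nu> \<le> wasserstein p lam \<mu> + wasserstein p \<mu> \<nu> + \<epsilon>"
    by (simp add: A_def B_def e_def)
qed

end
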